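(* Let $G=(V,E)$ be a finite, connected, undirected, unweighted graph with shortest-path distance $d$, and let $\mathbf{L}\subseteq V$ be a set of landmarks. Then the dual landmark heuristic $\pi_t^{DL}$ does not dominate the ALT heuristic $\pi_t^{L}$ over the same set of landmarks $\mathbf{L}$; that is, it is not the case in general that $\pi_t^{DL}(v)\ge\pi_t^{L}(v)$ for all vertices $v$ and targets $t$.
   Context: The ALT heuristic is $\pi_t^{L}(v)=\max_{l\in\mathbf{L}}|d(v,l)-d(t,l)|$. The dual landmark heuristic uses landmarks $l_1,l_2\in\mathbf{L}$ (under distributed embedding, $l_1$ is the landmark to which $v$ is assigned and $l_2$ the landmark to which $t$ is assigned, each vertex being assigned to exactly one landmark of $\mathbf{L}$) and is $\pi_t^{DL}(v)=\max_i\pi_t^{DL}(v,i)$ over the defined terms among $\pi_t^{DL}(v,1)=|d(v,l_1)-d(l_1,l_2)|-d(l_2,t)$, $\pi_t^{DL}(v,2)=|d(v,l_1)-d(l_2,t)|-d(l_1,l_2)$, $\pi_t^{DL}(v,3)=|d(l_1,l_2)-d(l_2,t)|-d(v,l_1)$, $\pi_t^{DL}(v,4)=|d(v,l_1)-d(l_1,t)|$, $\pi_t^{DL}(v,5)=|d(v,l_2)-d(l_2,t)|$ (terms 4 and 5 used only when $l_1=l_2$), $\pi_t^{DL}(v,6)=\dfrac{|d(v,l_1)-d(l_1,l_2)|\cdot|d(l_1,l_2)-d(l_2,t)|-d(v,l_1)\cdot d(l_2,t)}{d(l_1,l_2)}$ (only when $l_1\neq l_2$). A heuristic $h_1$ dominates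 a heuristic $h_2$ if $h_1(v)\ge h_2(v)$ for all vertices $v$ (and targets $t$). *)

theory Defs
  imports "Graph_Theory.Graph_Theory" "HOL-Library.FuncSet"
begin

text \<open>
  Finite simple undirected graphs are the finite, symmetric, loop-free pair digraphs of the
  library, as characterised by the locale predicate \<open>pair_graph\<close>.
  Being unweighted means that every arc has cost 1. The library distance is extended-real
  valued (infinite between different components); on connected graphs nothing is lost by
  passing to the reals.
\<close>

definition graph_dist :: "'a pair_pre_digraph \<Rightarrow> 'a \<Rightarrow> 'a \<Rightarrow> real" where
  "graph_dist G u v = real_of_ereal (wf_digraph.\<mu> (with_proj G) (\<lambda>_. 1) u v)"

text \<open>
  A heuristic takes the target \<open>t\<close> first and then the vertex \<open>v\<close>, so that \<open>h t v\<close> is the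
  estimate at \<open>v\<close> for target \<open>t\<close>.
\<close>

definition alt_heuristic :: "('a \<Rightarrow> 'a \<Rightarrow> real) \<Rightarrow> 'a set \<Rightarrow> 'a \<Rightarrow> 'a \<Rightarrow> real" where
  "alt_heuristic d L t v = (MAX l\<in>L. \<bar>d v l - d t l\<bar>)"

text \<open>
  The function \<open>a\<close> is the distributed embedding: it assigns to each vertex its landmark.
  In the case \<open>l1 = l2\<close> the sixth term is undefined (its denominator would be 0); in the case
  \<open>l1 \<noteq> l2\<close> the fourth and fifth terms are not used.
\<close>

definition dual_landmark_heuristic ::
    "('a \<Rightarrow> 'a \<Rightarrow> real) \<Rightarrow> ('a \<Rightarrow> 'a) \<Rightarrow> 'a \<Rightarrow> 'a \<Rightarrow> real" where
  "dual_landmark_heuristic d a t v =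
    (let l1 = a v; l2 = a t in
      Max ({\<bar>d v l1 - d l1 l2\<bar> - d l2 t,
            \<bar>d v l1 - d l2 t\<bar> - d l1 l2,
            \<bar>d l1 l2 - d l2 t\<bar> - d v l1} \<union>
           (if l1 = l2
            then {\<bar>d v l1 - d l1 t\<bar>,
                  \<bar>d v l2 - d l2 t\<bar>}
            else {(\<bar>d v l1 - d l1 l2\<bar> * \<bar>d l1 l2 - d l2 t\<bar> - d v l1 * d l2 t) / d l1 l2})))"

definition heuristic_dominates :: "'a set \<Rightarrow> ('a \<Rightarrow> 'a \<Rightarrow> real) \<Rightarrow> ('a \<Rightarrow> 'a \<Rightarrow> real) \<Rightarrow> bool" where
  "heuristic_dominates V h1 h2 \<longleftrightarrow> (\<forall>t\<in>V. \<forall>v\<in>V. h1 t v \<ge> h2 t v)"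

end

theory Submission
  imports Defs
begin

text \<open>
  ALT takes the maximum over all landmarks, whereas the dual heuristic only sees the landmarks
  assigned to \<open>v\<close> and \<open>t\<close>. On the path 0 - 1 - 2 - 3 with landmarks 0 and 2, assign 0 to itself
  and the other vertices to 2, which is a nearest landmark for each of them. The vertices \<open>v = 1\<close>
  and \<open>t = 3\<close> are equidistant from their common landmark 2, so all terms of the dual heuristic
  vanish, while landmark 0 gives ALT the exact distance 2.
\<close>

definition path_graph :: "nat \<Rightarrow> nat pair_pre_digraph" where
  "path_graph n = \<lparr> pverts = {..n}, parcs = {(i, j). i \<le> n \<and> j \<le> n \<and> (j = Suc i \<or> i = Suc j)} \<rparr>"

lemma path_graph_simps [simp]:
  "pverts (path_graph n) = {..n}"
  "(i, j) \<in> parcs (path_graph n) \<longleftrightarrow> i \<le> n \<and> j \<le> n \<and> (j = Suc i \<or> i = Suc j)"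
  by (simp_all add: path_graph_def)

lemma pair_graph_path_graph: "pair_graph (path_graph n)"
proof
  show "finite (parcs (path_graph n))"
    by (rule finite_subset[of _ "{..n} \<times> {..n}"]) (auto simp: path_graph_def)
  show "symmetric (with_proj (path_graph n))"
    by (auto simp: symmetric_def intro!: symI)
qed auto

interpretation path_graph: pair_graph "path_graph n" for n
  by (rule pair_graph_path_graph)

text \<open>Walking straight from \<open>u\<close> towards \<open>v\<close> never leaves the path.
  This bounds the distance from above and also supplies the walks needed for connectedness.\<close>

lemma path_graph_walk:
  assumes "u \<le> n" "v \<le> n"
  obtains p where "path_graph.awalk n u p v" "real (length p) = \<bar>real u - real v\<bar>"
proof -
  have "\<exists>p. path_graph.awalk n u p v \<and> real (length p) = \<bar>real u - real v\<bar>"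
    using assms
  proof (induction "nat \<bar>int u - int v\<bar>" arbitrary: u)
    case 0
    then have "path_graph.awalk n u [] v"
      by (simp add: path_graph.awalk_Nil_iff)
    with 0 show ?case
      by (intro exI[of _ "[]"]) simp
  next
    case (Suc k)
    \<comment> \<open>\<open>w\<close> is the neighbour of \<open>u\<close> one step closer to
      \<open>v\<close>. Here \<open>u\<close> and \<open>v\<close> differ, so the else branch has
      \<open>u > v\<close> and \<open>u - 1\<close> is not truncated.\<close>
    define w where "w = (if u < v then Suc u else u - 1)"
    have "k = nat \<bar>int w - int v\<bar>" "w \<le> n"
      using Suc.hyps(2) Suc.prems by (auto simp: w_def)
    then obtain p where p: "path_graph.awalk n w p v" "real (length p) = \<bar>real w - real v\<bar>"
      using Suc.hyps(1) Suc.prems by blast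
    have "path_graph.awalk n u ((u, w) # p) v"
      using p(1) Suc.hyps(2) Suc.prems
      by (auto simp: path_graph.awalk_Cons_iff w_def)
    moreover have "real (length ((u, w) # p)) = \<bar>real u - real v\<bar>"
      using p(2) Suc.hyps(2) by (auto simp: w_def of_nat_diff)
    ultimately show ?case by blast
  qed
  with that show thesis by blast
qed

text \<open>Each arc changes the vertex number by exactly 1, so the bound follows by the triangle
  inequality along the walk.\<close>

lemma path_graph_walk_length:
  assumes "path_graph.awalk n u p v"
  shows "\<bar>real u - real v\<bar> \<le> real (length p)"
  using assms
proof (induction p arbitrary: u)
  case Nil
  then show ?case by (simp add: path_graph.awalk_Nil_iff)
next
  case (Cons e p)
  then have "\<bar>real (snd e) - real v\<bar> \<le> real (length p)" "u = fst e" "e \<in> parcs (path_graph n)"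
    by (auto simp: path_graph.awalk_Cons_iff)
  then show ?case by (cases e) auto
qed

lemma graph_dist_path_graph:
  assumes "u \<le> n" "v \<le> n"
  shows "graph_dist (path_graph n) u v = \<bar>real u - real v\<bar>"
proof -
  have cost: "path_graph.awalk_cost (\<lambda>_. 1) p = real (length p)" for p
    by (simp add: path_graph.awalk_cost_def sum_list_triv)
  obtain p where p: "path_graph.awalk n u p v" "real (length p) = \<bar>real u - real v\<bar>"
    using path_graph_walk assms .
  have "path_graph.\<mu> n (\<lambda>_. 1) u v = ereal \<bar>real u - real v\<bar>"
  proof (rule antisym)
    show "path_graph.\<mu> n (\<lambda>_. 1) u v \<le> ereal \<bar>real u - real v\<bar>"
      using path_graph.min_cost_le_walk_cost[OF p(1), of "\<lambda>_. 1"] by (simp only: cost p(2))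
    \<comment> \<open>\<open>\<mu>\<close> is the infimum of the costs of all walks, so a lower
      bound valid for every single walk suffices.\<close>
    show "ereal \<bar>real u - real v\<bar> \<le> path_graph.\<mu> n (\<lambda>_. 1) u v"
      unfolding path_graph.\<mu>_def cost
      by (intro INF_greatest) (use path_graph_walk_length in auto)
  qed
  then show ?thesis by (simp add: graph_dist_def)
qed

text \<open>Connectedness refers to the symmetric closure, and reachability in the path itself
  carries over to it.\<close>

lemma connected_path_graph: "Digraph_Component.connected (with_proj (path_graph n))"
  unfolding Digraph_Component.connected_def
proof
  show "verts (with_proj (mk_symmetric (with_proj (path_graph n)))) \<noteq> {}"
    by auto
next
  fix u v
  assume "u \<in> verts (with_proj (mk_symmetric (with_proj (path_graph n))))"
    and "v \<in> verts (with_proj (mk_symmetric (with_proj (path_graph n))))"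
  then obtain p where "path_graph.awalk n u p v"
    using path_graph_walk[of u n v] by auto
  then show "u \<rightarrow>\<^sup>*\<^bsub>with_proj (mk_symmetric (with_proj (path_graph n)))\<^esub> v"
    by (intro path_graph.reachable_mk_symmetricI path_graph.reachable_awalkI)
qed

theorem theorem3:
  shows "\<not> (\<forall>(G :: nat pair_pre_digraph) L a.
      pair_graph G \<longrightarrow> Digraph_Component.connected (with_proj G) \<longrightarrow>
      L \<subseteq> pverts G \<longrightarrow> a \<in> pverts G \<rightarrow> L \<longrightarrow>
      heuristic_dominates (pverts G) (dual_landmark_heuristic (graph_dist G) a)
        (alt_heuristic (graph_dist G) L))"
proof
  let ?G = "path_graph 3"
  let ?L = "{0, 2} :: nat set"
  let ?a = "\<lambda>v::nat. if v = 0 then 0 else 2 :: nat"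
  assume "\<forall>(G :: nat pair_pre_digraph) L a.
      pair_graph G \<longrightarrow> Digraph_Component.connected (with_proj G) \<longrightarrow>
      L \<subseteq> pverts G \<longrightarrow> a \<in> pverts G \<rightarrow> L \<longrightarrow>
      heuristic_dominates (pverts G) (dual_landmark_heuristic (graph_dist G) a)
        (alt_heuristic (graph_dist G) L)"
  moreover have "?L \<subseteq> pverts ?G" "?a \<in> pverts ?G \<rightarrow> ?L"
    by auto
  ultimately have "heuristic_dominates (pverts ?G) (dual_landmark_heuristic (graph_dist ?G) ?a)
      (alt_heuristic (graph_dist ?G) ?L)"
    using pair_graph_path_graph connected_path_graph by blast
  then have "alt_heuristic (graph_dist ?G) ?L 3 1 \<le> dual_landmark_heuristic (graph_dist ?G) ?a 3 1"
    by (simp add: heuristic_dominates_def)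
  \<comment> \<open>Landmark 0 contributes |1 - 3| = 2, landmark 2 only |1 - 1| = 0.\<close>
  moreover have "alt_heuristic (graph_dist ?G) ?L 3 1 = 2"
    by (simp add: alt_heuristic_def graph_dist_path_graph)
  \<comment> \<open>Here \<open>l1 = l2 = 2\<close>, so \<open>d l1 l2 = 0\<close>, terms 4 and 5
    apply, and \<open>d v l1 = d l2 t = 1\<close> cancels in each term.\<close>
  moreover have "dual_landmark_heuristic (graph_dist ?G) ?a 3 1 = 0"
    by (simp add: dual_landmark_heuristic_def graph_dist_path_graph)
  ultimately show False by simp
qed

end
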